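(* Let $n\ge 2$ and let $\mathcal{C}$ be a complete set of measurement bases of an $n$-dimensional complex Hilbert space $\mathcal{H}$, with transition probabilities $s^{kl}_{ij}$, Gram matrix $\Gamma(\mathcal{C})$, and block-diagonal part $\Gamma_0$ of $\Gamma(\mathcal{C})$. Let $\varepsilon>0$ be such that $|s^{kl}_{ij}-s^{kl}_{ir}|<\varepsilon$ for all $k,l\in\{1,\dots,n+1\}$ with $k\neq l$ and all $i,j,r\in\{1,\dots,n\}$. Let $\Gamma'=\Gamma(\mathcal{C})-I_{n^2-1}$, where $I_{n^2-1}$ is the identity matrix of order $n^2-1$, and let $\lambda_m$ be the minimum eigenvalue of $\Gamma'$. Then $$\exp\!\left(\frac{(n^2-n)^2(n^2-1)\,\varepsilon^2}{1+\lambda_m}\right)\frac{\det\Gamma(\mathcal{C})}{\det\Gamma_0}\;\ge\;1 .$$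
   Context: Let $\mathcal{H}$ be a complex Hilbert space of finite dimension $n$. For $k=1,\dots,n+1$ let $\{|\alpha_i^k\rangle\}_{i=1}^n$ be an orthonormal basis of $\mathcal{H}$ and let $P_i^k=|\alpha_i^k\rangle\langle\alpha_i^k|$ be the corresponding rank-one orthogonal projections. Real vector spaces of Hermitian operators carry the inner product $\langle B,C\rangle=\mathrm{Tr}(B^\dagger C)$. Put $T_i^k=P_i^k-I/n$, a traceless Hermitian operator. The collection $\mathcal{C}$ of these $n+1$ bases is called a complete set of measurement bases (CSMB) if the $n^2-1$ operators $T_i^k$, $1\le i\le n-1$, $1\le k\le n+1$, are linearly independent, i.e. form a basis of the $(n^2-1)$-dimensional real space of traceless Hermitian operators on $\mathcal{H}$. The transition probabilities are $s^{kl}_{ij}=\mathrm{Tr}(P_i^kP_j^l)=|\langle\alpha_i^k|\alpha_j^l\rangle|^2$, $1\le i,j\le n$, $1\le k,l\le n+1$. The matrix $\Gamma(\mathcal{C})$ is the real $(n^2-1)\times(n^2-1)$ Gram matrix with rows indexed by $(k,i)$ and columns by $(l,j)$, $1\le k,l\le n+1$, $1\le i,j\le n-1$, and entries $\langle T_i^k,T_j^l\rangle=s_{ij}^{kl}-1/n$. It is viewed as an $(n+1)\times(n+1)$ array of blocks $\gamma^{kl}$ of size $(n-1)\times(n-1)$, with $\gamma^{kl}_{ij}=s^{kl}_{ij}-1/n$. The matrix $\Gamma_0$ is the $(n^2-1)\times(n^2-1)$ block-diagonal matrix with diagonal blocks $\gamma^{11},\dots,\gamma^{n+1,n+1}$ and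 all other blocks zero. *)

theory Defs
  imports Complex_Main "Jordan_Normal_Form.Spectral_Radius"
begin

section \<open>Complex inner product spaces\<close>

text \<open>
  The inner product is linear in its second argument (bra-ket convention). Only spaces of
  finite dimension are used below, and those are automatically complete, so a Hilbert space of
  dimension \<open>n\<close> is a type of this class with \<open>cvec.dim UNIV = n\<close>.
\<close>

class complex_inner_space = ab_group_add +
  fixes scaleC :: "complex \<Rightarrow> 'a \<Rightarrow> 'a" (infixr "*\<^sub>C" 75)
    and cinner :: "'a \<Rightarrow> 'a \<Rightarrow> complex"
  assumes scaleC_add_right: "c *\<^sub>C (x + y) = c *\<^sub>C x + c *\<^sub>C y"
    and scaleC_add_left: "(c + d) *\<^sub>C x = c *\<^sub>C x + d *\<^sub>C x"
    and scaleC_scaleC: "c *\<^sub>C d *\<^sub>C x = (c * d) *\<^sub>C x"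
    and scaleC_one: "1 *\<^sub>C x = x"
    and cinner_commute: "cinner x y = cnj (cinner y x)"
    and cinner_add_right: "cinner x (y + z) = cinner x y + cinner x z"
    and cinner_scaleC_right: "cinner x (c *\<^sub>C y) = c * cinner x y"
    and cinner_pos: "x \<noteq> 0 \<Longrightarrow> 0 < Re (cinner x x)"

text \<open>Since \<open>vector_space.dim\<close> is \<open>0\<close> for infinite-dimensional spaces,
  \<open>cvec.dim UNIV = n\<close> with \<open>n > 0\<close> entails finite dimension.\<close>

global_interpretation cvec: vector_space "scaleC :: complex \<Rightarrow> 'a \<Rightarrow> 'a::complex_inner_space"
  by unfold_locales
    (simp_all add: scaleC_add_right scaleC_add_left scaleC_scaleC scaleC_one)

text \<open>Families of \<open>n\<close> objects are functions on \<open>nat\<close>, of which only the values at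
  \<open>0, \<dots>, n - 1\<close> matter.\<close>

definition orthonormal_basis :: "nat \<Rightarrow> (nat \<Rightarrow> 'a::complex_inner_space) \<Rightarrow> bool" where
  "orthonormal_basis n e \<longleftrightarrow>
     (\<forall>i<n. \<forall>j<n. cinner (e i) (e j) = (if i = j then 1 else 0)) \<and>
     cvec.span (e ` {..<n}) = UNIV"

section \<open>Operators\<close>

text \<open>The trace is the sum of the diagonal matrix entries in an orthonormal basis; for linear
  operators it does not depend on the basis. The adjoint is
  the operator \<open>A'\<close> with \<open>\<langle>A x, y\<rangle> = \<langle>x, A' y\<rangle>\<close>, unique where it exists.\<close>

definition ctrace :: "('a::complex_inner_space \<Rightarrow> 'a) \<Rightarrow> complex" where
  "ctrace A =
     (let n = cvec.dim (UNIV :: 'a set); e = (SOME e. orthonormal_basis n e)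
      in \<Sum>i<n. cinner (e i) (A (e i)))"

definition cadjoint :: "('a::complex_inner_space \<Rightarrow> 'a) \<Rightarrow> 'a \<Rightarrow> 'a" where
  "cadjoint A = (SOME A'. \<forall>x y. cinner (A x) y = cinner x (A' y))"

text \<open>On Hermitian operators \<open>Tr (B\<^sup>\<dagger> C)\<close> is real, so that taking the real part
  there is only a change of type.\<close>

definition hs_inner :: "('a::complex_inner_space \<Rightarrow> 'a) \<Rightarrow> ('a \<Rightarrow> 'a) \<Rightarrow> real" where
  "hs_inner B C = Re (ctrace (cadjoint B \<circ> C))"

definition proj1 :: "'a::complex_inner_space \<Rightarrow> 'a \<Rightarrow> 'a" where
  "proj1 a = (\<lambda>x. cinner a x *\<^sub>C a)"

definition traceless_proj :: "nat \<Rightarrow> 'a::complex_inner_space \<Rightarrow> 'a \<Rightarrow> 'a" where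
  "traceless_proj n a = (\<lambda>x. proj1 a x - (1 / of_nat n) *\<^sub>C x)"

section \<open>Complete sets of measurement bases\<close>

text \<open>\<open>\<alpha> k i\<close>, for \<open>k < n + 1\<close> and \<open>i < n\<close>, is the \<open>i\<close>-th vector of the
  \<open>k\<close>-th basis; both indices start at \<open>0\<close>. Linear independence of the traceless
  operators is that of an indexed family, over the reals.\<close>

definition csmb :: "nat \<Rightarrow> (nat \<Rightarrow> nat \<Rightarrow> 'a::complex_inner_space) \<Rightarrow> bool" where
  "csmb n \<alpha> \<longleftrightarrow>
     (\<forall>k<n + 1. orthonormal_basis n (\<alpha> k)) \<and>
     (\<forall>c :: nat \<Rightarrow> nat \<Rightarrow> real.
        (\<forall>x. (\<Sum>k<n + 1. \<Sum>i<n - 1. of_real (c k i) *\<^sub>C traceless_proj n (\<alpha> k i) x) = 0)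
        \<longrightarrow> (\<forall>k<n + 1. \<forall>i<n - 1. c k i = 0))"

definition transition_prob ::
    "(nat \<Rightarrow> nat \<Rightarrow> 'a::complex_inner_space) \<Rightarrow> nat \<Rightarrow> nat \<Rightarrow> nat \<Rightarrow> nat \<Rightarrow> real" where
  "transition_prob \<alpha> k l i j = Re (ctrace (proj1 (\<alpha> k i) \<circ> proj1 (\<alpha> l j)))"

text \<open>The index pair \<open>(k, i)\<close> with \<open>i < n - 1\<close> is encoded as the row (or column) number
  \<open>k * (n - 1) + i\<close>.\<close>

definition gram :: "nat \<Rightarrow> (nat \<Rightarrow> nat \<Rightarrow> 'a::complex_inner_space) \<Rightarrow> real mat" where
  "gram n \<alpha> = mat (n\<^sup>2 - 1) (n\<^sup>2 - 1) (\<lambda>(a, b).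
     hs_inner (traceless_proj n (\<alpha> (a div (n - 1)) (a mod (n - 1))))
              (traceless_proj n (\<alpha> (b div (n - 1)) (b mod (n - 1)))))"

definition gram_diag :: "nat \<Rightarrow> (nat \<Rightarrow> nat \<Rightarrow> 'a::complex_inner_space) \<Rightarrow> real mat" where
  "gram_diag n \<alpha> = mat (n\<^sup>2 - 1) (n\<^sup>2 - 1) (\<lambda>(a, b).
     if a div (n - 1) = b div (n - 1) then gram n \<alpha> $$ (a, b) else 0)"

section \<open>The entries in terms of the inner product\<close>

lemma cinner_add_left: "cinner (x + y) z = cinner x z + cinner y (z::'a::complex_inner_space)"
  by (metis cinner_commute cinner_add_right complex_cnj_add)
lemma cinner_scaleC_left: "cinner (c *\<^sub>C x) z = cnj c * cinner x (z::'a::complex_inner_space)"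
  by (metis cinner_commute cinner_scaleC_right complex_cnj_mult)
lemma cinner_zero_right [simp]: "cinner x (0::'a::complex_inner_space) = 0"
  using cinner_add_right[of x 0 0] by simp
lemma cinner_zero_left [simp]: "cinner (0::'a::complex_inner_space) x = 0"
  using cinner_add_left[of 0 0 x] by simp
lemma cinner_diff_right: "cinner x (y - z) = cinner x y - cinner x (z::'a::complex_inner_space)"
  using cinner_add_right[of x "y - z" z] by simp
lemma cinner_diff_left: "cinner (x - y) z = cinner x z - cinner y (z::'a::complex_inner_space)"
  using cinner_add_left[of "x - y" y z] by simp
lemma cinner_sum_right: "cinner x (\<Sum>i\<in>A. f i) = (\<Sum>i\<in>A. cinner x (f i :: 'a::complex_inner_space))"
  by (induction A rule: infinite_finite_induct) (auto simp: cinner_add_right)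

lemma cinner_eq_0: "cinner x x = 0 \<Longrightarrow> x = (0::'a::complex_inner_space)"
  using cinner_pos[of x] by auto

lemma orthonormal_basis_expand:
  assumes "orthonormal_basis n e"
  shows "(x::'a::complex_inner_space) = (\<Sum>i<n. cinner (e i) x *\<^sub>C e i)"
proof -
  define z where "z = x - (\<Sum>i<n. cinner (e i) x *\<^sub>C e i)"
  have o: "cinner (e j) z = 0" if "j < n" for j
  proof -
    have "(\<Sum>i<n. cinner (e i) x * cinner (e j) (e i)) = (\<Sum>i<n. if i = j then cinner (e i) x else 0)"
      using assms that by (intro sum.cong) (auto simp: orthonormal_basis_def)
    then show ?thesis using that
      by (simp add: z_def cinner_diff_right cinner_sum_right cinner_scaleC_right)
  qed
  have "cinner y z = 0" if "y \<in> cvec.span (e ` {..<n})" for y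
    using that
    by (induction rule: cvec.span_induct_alt) (auto simp: o cinner_add_left cinner_scaleC_left)
  then have "z = 0" using assms by (auto intro: cinner_eq_0 simp: orthonormal_basis_def)
  then show ?thesis by (simp add: z_def)
qed

lemma parseval:
  assumes "orthonormal_basis n e"
  shows "(\<Sum>i<n. cinner x (e i) * cinner (e i) y) = cinner x (y::'a::complex_inner_space)"
  by (subst (2) orthonormal_basis_expand[OF assms, of y])
    (simp add: cinner_sum_right cinner_scaleC_right mult.commute)

lemma ctrace_orthonormal_basis:
  assumes "cvec.dim (UNIV :: 'a::complex_inner_space set) = n" "orthonormal_basis n (a :: nat \<Rightarrow> 'a)"
  obtains e where "orthonormal_basis n e" "\<And>A :: 'a \<Rightarrow> 'a. ctrace A = (\<Sum>i<n. cinner (e i) (A (e i)))"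
  using assms someI[of "orthonormal_basis n" a] that
  unfolding ctrace_def Let_def by metis

lemma cadjoint_eqI: assumes "\<And>x y. cinner (A x) y = cinner x (A y)"
  shows "cadjoint A = (A :: 'a::complex_inner_space \<Rightarrow> 'a)"
proof -
  have "\<forall>x y. cinner (A x) y = cinner x (cadjoint A y)"
    unfolding cadjoint_def by (rule someI[of _ A]) (use assms in auto)
  then have "cinner x (cadjoint A y - A y) = 0" for x y
    using assms by (simp add: cinner_diff_right)
  then have "cadjoint A y - A y = 0" for y by (blast intro: cinner_eq_0)
  then show ?thesis by (simp add: fun_eq_iff)
qed

lemma cadjoint_traceless_proj: "cadjoint (traceless_proj n a) = traceless_proj n a"
  by (rule cadjoint_eqI) (simp add: traceless_proj_def proj1_def cinner_diff_left cinner_diff_right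
     cinner_scaleC_left cinner_scaleC_right flip: cinner_commute)

lemma transition_prob_eq:
  assumes "cvec.dim (UNIV :: 'a::complex_inner_space set) = n" "csmb n (\<alpha> :: nat \<Rightarrow> nat \<Rightarrow> 'a)"
  shows "transition_prob \<alpha> k l i j = (cmod (cinner (\<alpha> k i) (\<alpha> l j)))\<^sup>2"
proof -
  have "orthonormal_basis n (\<alpha> 0)" using assms(2) by (simp add: csmb_def)
  from ctrace_orthonormal_basis[OF assms(1) this] obtain e :: "nat \<Rightarrow> 'a" where e: "orthonormal_basis n e"
    and t: "\<And>A :: 'a \<Rightarrow> 'a. ctrace A = (\<Sum>i<n. cinner (e i) (A (e i)))" by metis
  let ?x = "\<alpha> k i" and ?y = "\<alpha> l j"
  have "ctrace (proj1 ?x \<circ> proj1 ?y) = (\<Sum>i<n. cinner ?x ?y * (cinner ?y (e i) * cinner (e i) ?x))"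
    by (auto simp: t proj1_def cinner_scaleC_right mult_ac intro!: sum.cong)
  also have "\<dots> = cinner ?x ?y * cinner ?y ?x"
    by (simp add: parseval[OF e] flip: sum_distrib_left)
  also have "\<dots> = of_real ((cmod (cinner ?x ?y))\<^sup>2)"
    by (subst cinner_commute[of ?y]) (simp only: complex_norm_square)
  finally show ?thesis by (simp add: transition_prob_def del: of_real_power)
qed

lemma hs_inner_traceless_proj:
  assumes "cvec.dim (UNIV :: 'a::complex_inner_space set) = n" "csmb n (\<alpha> :: nat \<Rightarrow> nat \<Rightarrow> 'a)"
    and "k < n + 1" "l < n + 1" "i < n" "j < n"
  shows "hs_inner (traceless_proj n (\<alpha> k i)) (traceless_proj n (\<alpha> l j)) =
    transition_prob \<alpha> k l i j - 1 / real n"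
proof -
  have "orthonormal_basis n (\<alpha> 0)" using assms(2) by (simp add: csmb_def)
  from ctrace_orthonormal_basis[OF assms(1) this] obtain e :: "nat \<Rightarrow> 'a" where e: "orthonormal_basis n e"
    and t: "\<And>A :: 'a \<Rightarrow> 'a. ctrace A = (\<Sum>i<n. cinner (e i) (A (e i)))" by metis
  let ?x = "\<alpha> k i" and ?y = "\<alpha> l j"
  define m where "m = (1 / of_nat n :: complex)"
  have 1: "cinner ?x ?x = 1" "cinner ?y ?y = 1" using assms by (auto simp: csmb_def orthonormal_basis_def)
  have ee: "(\<Sum>i<n. cinner (e i) (e i)) = of_nat n" using e by (simp add: orthonormal_basis_def)
  have "ctrace (traceless_proj n ?x \<circ> traceless_proj n ?y)
    = (\<Sum>i<n. cinner (e i) (proj1 ?x (proj1 ?y (e i))) - m * (cinner ?x (e i) * cinner (e i) ?x)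
        - m * (cinner ?y (e i) * cinner (e i) ?y) + m * m * cinner (e i) (e i))"
    by (auto simp: t m_def[symmetric] traceless_proj_def proj1_def cinner_scaleC_right cinner_diff_right cinner_add_right algebra_simps intro!: sum.cong)
  also have "\<dots> = ctrace (proj1 ?x \<circ> proj1 ?y) - m * cinner ?x ?x - m * cinner ?y ?y + m * m * of_nat n"
    by (simp add: sum.distrib sum_subtractf t parseval[OF e] ee flip: sum_distrib_left)
  also have "\<dots> = ctrace (proj1 ?x \<circ> proj1 ?y) - of_real (1 / real n)"
    using assms(5) by (simp add: 1 m_def field_simps)
  finally show ?thesis by (simp add: hs_inner_def cadjoint_traceless_proj transition_prob_def)
qed

end

theory Submission
  imports Defs
begin

text \<open>
  Write \<open>\<Gamma> = \<Gamma>\<^sub>0 M\<close> and \<open>\<mu> = 1 + \<lambda>\<^sub>m > 0\<close>, the least eigenvalue of \<open>\<Gamma>\<close>. An eigenvector \<open>v\<close> of \<open>M\<close> for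
  \<open>x\<close> satisfies \<open>\<Gamma> v = x \<Gamma>\<^sub>0 v\<close>, and \<open>\<mu> I \<le> \<Gamma>\<close>, \<open>0 \<le> \<Gamma>\<^sub>0 \<le> I\<close>, so \<open>x\<close> is real and \<open>x \<ge> \<mu>\<close>. Hence
  \<open>ln x \<ge> 1 - 1 / x \<ge> (x - 1) - (x - 1)\<^sup>2 / \<mu>\<close>; summing over the eigenvalues and using that the trace of
  \<open>M - I\<close> vanishes gives \<open>ln det M \<ge> - Tr ((M - I)\<^sup>2) / \<mu>\<close>. The off-diagonal blocks of \<open>M\<close> have
  entries \<open>s\<^sub>i\<^sub>j - s\<^sub>n\<^sub>j\<close>, each smaller than \<open>\<epsilon>\<close>, so the trace is at most \<open>(n\<^sup>2 - 1)\<^sup>2 \<epsilon>\<^sup>2\<close>, and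
  \<open>n\<^sup>2 - 1 \<le> (n\<^sup>2 - n)\<^sup>2\<close>.
\<close>

section \<open>Eigenvalues and traces\<close>

lemma trace_mult_commute:
  fixes A B :: "'a::comm_semiring_0 mat"
  assumes "A \<in> carrier_mat d d" "B \<in> carrier_mat d d"
  shows "(\<Sum>i<d. (A * B) $$ (i, i)) = (\<Sum>i<d. (B * A) $$ (i, i))"
proof -
  have "(\<Sum>i<d. (A * B) $$ (i, i)) = (\<Sum>i<d. \<Sum>j<d. A $$ (i, j) * B $$ (j, i))"
    using assms by (intro sum.cong) (auto simp: scalar_prod_def atLeast0LessThan)
  also have "\<dots> = (\<Sum>j<d. \<Sum>i<d. B $$ (j, i) * A $$ (i, j))"
    by (subst sum.swap) (simp add: mult.commute)
  also have "\<dots> = (\<Sum>j<d. (B * A) $$ (j, j))"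
    using assms by (intro sum.cong) (auto simp: scalar_prod_def atLeast0LessThan)
  finally show ?thesis .
qed

lemma trace_conjugate:
  fixes B P Q :: "'a::comm_ring_1 mat"
  assumes [simp]: "B \<in> carrier_mat d d" "P \<in> carrier_mat d d" "Q \<in> carrier_mat d d"
    and QP: "Q * P = 1\<^sub>m d"
  shows "(\<Sum>i<d. (P * B * Q) $$ (i, i)) = (\<Sum>i<d. B $$ (i, i))"
proof -
  have "(\<Sum>i<d. (P * B * Q) $$ (i, i)) = (\<Sum>i<d. (Q * (P * B)) $$ (i, i))"
    by (rule trace_mult_commute) (auto intro: mult_carrier_mat[of _ d d])
  also have "Q * (P * B) = Q * P * B"
    by (rule assoc_mult_mat[OF assms(3,2,1), symmetric])
  finally show ?thesis using left_mult_one_mat[OF assms(1)] by (simp add: QP)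
qed

text \<open>Schur triangularisation: the diagonal of an upper triangular matrix similar to
  \<open>M\<close> lists the eigenvalues with multiplicity. Determinant and traces survive the
  similarity, and the double sum is the trace of \<open>M * M\<close>.\<close>

lemma complex_mat_eigenvalues:
  fixes M :: "complex mat"
  assumes M: "M \<in> carrier_mat d d"
  obtains z where "Determinant.det M = (\<Prod>i<d. z i)" "(\<Sum>i<d. M $$ (i, i)) = (\<Sum>i<d. z i)"
    "(\<Sum>i<d. \<Sum>j<d. M $$ (i, j) * M $$ (j, i)) = (\<Sum>i<d. (z i)\<^sup>2)"
    "\<And>i. i < d \<Longrightarrow> eigenvalue M (z i)"
proof -
  obtain es where "char_poly M = (\<Prod>a\<leftarrow>es. [:- a, 1:])"
    using char_poly_factorized[OF M] by blast
  from schur_decomposition_exists[OF M this] obtain B where B: "B \<in> carrier_mat d d"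
    and ut: "upper_triangular B" and sim: "similar_mat M B" by blast
  from sim obtain P Q where "similar_mat_wit M B P Q" by (auto simp: similar_mat_def)
  from similar_mat_witD2[OF M this] have QP: "Q * P = 1\<^sub>m d"
    and eq: "M = P * B * Q" and P: "P \<in> carrier_mat d d" and Q: "Q \<in> carrier_mat d d" by auto
  have "M * M = P * (B * (Q * P) * B) * Q"
    unfolding eq using B P Q by (simp add: assoc_mult_mat[of _ d d _ d _ d])
  then have MM: "M * M = P * (B * B) * Q" using B by (simp add: QP)
  have B0: "B $$ (i, j) = 0" if "i < d" "j < i" for i j
    using that ut B by (auto simp: upper_triangular_def)
  have "(\<Sum>j<d. B $$ (i, j) * B $$ (j, i)) = (B $$ (i, i))\<^sup>2" if "i < d" for i
  proof -
    \<comment> \<open>For \<open>i \<noteq> j\<close> one of the two factors lies below the diagonal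
      and vanishes.\<close>
    have "B $$ (i, j) * B $$ (j, i) = (if j = i then (B $$ (i, i))\<^sup>2 else 0)" if "j < d" for j
      using that \<open>i < d\<close> B0[of i j] B0[of j i] by (cases i j rule: linorder_cases) (auto simp: power2_eq_square)
    then show ?thesis using that by simp
  qed
  moreover have tr2: "(\<Sum>i<d. \<Sum>j<d. X $$ (i, j) * X $$ (j, i)) = (\<Sum>i<d. (X * X) $$ (i, i))"
    if "X \<in> carrier_mat d d" for X :: "complex mat"
    using that by (intro sum.cong) (auto simp: scalar_prod_def atLeast0LessThan)
  ultimately have BB: "(\<Sum>i<d. (B * B) $$ (i, i)) = (\<Sum>i<d. (B $$ (i, i))\<^sup>2)"
    using tr2[OF B] by simp
  show ?thesis
  proof
    show "Determinant.det M = (\<Prod>i<d. B $$ (i, i))"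
      using B det_similar[OF sim] det_upper_triangular[OF ut B]
      by (simp add: prod_list_diag_prod atLeast0LessThan)
    show "(\<Sum>i<d. M $$ (i, i)) = (\<Sum>i<d. B $$ (i, i))"
      unfolding eq by (rule trace_conjugate[OF B P Q QP])
    show "(\<Sum>i<d. \<Sum>j<d. M $$ (i, j) * M $$ (j, i)) = (\<Sum>i<d. (B $$ (i, i))\<^sup>2)"
      unfolding tr2[OF M] MM using trace_conjugate[of "B * B" d P Q] B P Q QP BB by simp
    fix i assume i: "i < d"
    have "char_poly M = (\<Prod>a\<leftarrow>diag_mat B. [:- a, 1:])"
      using char_poly_similar[OF sim] char_poly_upper_triangular[OF B ut] by simp
    moreover have "B $$ (i, i) \<in> set (diag_mat B)" using i B by (auto simp: diag_mat_def)
    ultimately have "poly (char_poly M) (B $$ (i, i)) = 0"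
      using linear_poly_root by metis
    then show "eigenvalue M (B $$ (i, i))" using eigenvalue_root_char_poly[OF M] by blast
  qed
qed

text \<open>The tangent bound \<open>exp y \<ge> 1 + y\<close> at \<open>y = 1 / x - 1\<close>, in
  multiplicative form. The linear term is kept apart because it cancels in the product over all
  eigenvalues; the denominator \<open>\<mu>\<close> is common to them all.\<close>

lemma one_le_mult_exp:
  fixes x \<mu> :: real
  assumes "0 < \<mu>" "\<mu> \<le> x"
  shows "1 \<le> x * exp ((x - 1)\<^sup>2 / \<mu> - (x - 1))"
proof -
  have x: "x > 0" using assms by simp
  have "1 / x \<le> exp (1 / x - 1)" using exp_ge_add_one_self[of "1 / x - 1"] by simp
  moreover have "1 / x - 1 = (x - 1)\<^sup>2 / x - (x - 1)"
    using x by (simp add: field_simps power2_eq_square)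
  moreover have "(x - 1)\<^sup>2 / x \<le> (x - 1)\<^sup>2 / \<mu>" using assms by (intro divide_left_mono) auto
  ultimately have "1 / x \<le> exp ((x - 1)\<^sup>2 / \<mu> - (x - 1))"
    by (smt (verit) exp_le_cancel_iff)
  then show ?thesis using x by (simp add: field_simps)
qed

text \<open>The product of \<open>one_le_mult_exp\<close> over the eigenvalues. The trace hypothesis
  makes the linear terms sum to zero and turns the sum of the \<open>(x i - 1)\<^sup>2\<close> into
  the trace of \<open>M * M\<close> minus \<open>d\<close>.\<close>

lemma det_lower_bound_trace:
  fixes M :: "real mat" and \<mu> :: real
  assumes M: "M \<in> carrier_mat d d" and \<mu>: "0 < \<mu>"
    and ev: "\<And>z. eigenvalue (map_mat complex_of_real M) z \<Longrightarrow> \<exists>x\<ge>\<mu>. z = of_real x"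
    and tr: "(\<Sum>i<d. M $$ (i, i)) = real d"
  shows "1 \<le> exp (((\<Sum>i<d. \<Sum>j<d. M $$ (i, j) * M $$ (j, i)) - real d) / \<mu>) * Determinant.det M"
proof -
  let ?C = "map_mat complex_of_real M"
  have C: "?C \<in> carrier_mat d d" using M by simp
  obtain z where z: "Determinant.det ?C = (\<Prod>i<d. z i)" "(\<Sum>i<d. ?C $$ (i, i)) = (\<Sum>i<d. z i)"
    "(\<Sum>i<d. \<Sum>j<d. ?C $$ (i, j) * ?C $$ (j, i)) = (\<Sum>i<d. (z i)\<^sup>2)"
    "\<And>i. i < d \<Longrightarrow> eigenvalue ?C (z i)"
    using complex_mat_eigenvalues[OF C] by blast
  have "\<forall>i. \<exists>x. i < d \<longrightarrow> x \<ge> \<mu> \<and> z i = of_real x" using ev z(4) by blast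
  then obtain x where x: "\<And>i. i < d \<Longrightarrow> x i \<ge> \<mu> \<and> z i = of_real (x i)" by metis
  have "complex_of_real (Determinant.det M) = of_real (\<Prod>i<d. x i)"
    using z(1) x by (simp add: of_real_hom.hom_det)
  then have det: "Determinant.det M = (\<Prod>i<d. x i)" using of_real_eq_iff by blast
  have "complex_of_real (\<Sum>i<d. M $$ (i, i)) = of_real (\<Sum>i<d. x i)"
    using z(2) x M by simp
  then have s1: "(\<Sum>i<d. x i) = real d" unfolding tr using of_real_eq_iff by metis
  have "complex_of_real (\<Sum>i<d. \<Sum>j<d. M $$ (i, j) * M $$ (j, i)) = of_real (\<Sum>i<d. (x i)\<^sup>2)"
    using z(3) x M by simp
  then have s2: "(\<Sum>i<d. \<Sum>j<d. M $$ (i, j) * M $$ (j, i)) = (\<Sum>i<d. (x i)\<^sup>2)"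
    using of_real_eq_iff by blast
  have "(\<Sum>i<d. (x i - 1)\<^sup>2 / \<mu> - (x i - 1)) = ((\<Sum>i<d. (x i)\<^sup>2) - real d) / \<mu>"
    using s1 by (simp add: sum_subtractf sum.distrib power2_diff flip: sum_divide_distrib sum_distrib_left)
  then have "(\<Prod>i<d. x i * exp ((x i - 1)\<^sup>2 / \<mu> - (x i - 1)))
      = exp (((\<Sum>i<d. (x i)\<^sup>2) - real d) / \<mu>) * (\<Prod>i<d. x i)"
    by (simp add: prod.distrib flip: exp_sum)
  moreover have "1 \<le> (\<Prod>i<d. x i * exp ((x i - 1)\<^sup>2 / \<mu> - (x i - 1)))"
    using one_le_mult_exp[OF \<mu>] x by (intro prod_ge_1) auto
  ultimately show ?thesis unfolding s2 det by (simp only:)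
qed

section \<open>Quadratic forms\<close>

text \<open>Matrices and vectors are plain functions here, so that shifted, masked and constant
  matrices need no \<open>mat\<close> of their own; only indices below \<open>d\<close>
  count.\<close>

definition bform :: "nat \<Rightarrow> (nat \<Rightarrow> nat \<Rightarrow> real) \<Rightarrow> (nat \<Rightarrow> real) \<Rightarrow> (nat \<Rightarrow> real) \<Rightarrow> real" where
  "bform d M x y = (\<Sum>i<d. \<Sum>j<d. x i * M i j * y j)"

lemma bform_commute:
  assumes "\<And>i j. i < d \<Longrightarrow> j < d \<Longrightarrow> M i j = M j i"
  shows "bform d M x y = bform d M y x"
  unfolding bform_def by (subst sum.swap) (auto simp: assms mult_ac intro!: sum.cong)

lemma bform_diff_scale:
  "bform d M (\<lambda>i. x i - s * y i) (\<lambda>i. x i - s * y i)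
   = bform d M x x - s * bform d M x y - s * bform d M y x + s\<^sup>2 * bform d M y y"
  unfolding bform_def
  by (simp add: algebra_simps sum.distrib sum_subtractf sum_distrib_left power2_eq_square)

text \<open>Each \<open>\<bar>x i\<bar> * \<bar>x j\<bar>\<close> is at most the sum of squares, by
  the inequality of the means. The bound is crude, but only the existence of some constant
  matters.\<close>

lemma bform_abs_le:
  "\<bar>bform d M x x\<bar> \<le> (\<Sum>i<d. \<Sum>j<d. \<bar>M i j\<bar>) * (\<Sum>i<d. (x i)\<^sup>2)"
proof -
  let ?S = "\<Sum>i<d. (x i)\<^sup>2"
  have le: "\<bar>x i * M i j * x j\<bar> \<le> \<bar>M i j\<bar> * ?S" if "i < d" "j < d" for i j
  proof -
    have "(x k)\<^sup>2 \<le> ?S" if "k < d" for k using that by (intro member_le_sum) auto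
    from this[of i] this[of j] that have "(x i)\<^sup>2 + (x j)\<^sup>2 \<le> 2 * ?S" by simp
    moreover have "2 * (\<bar>x i\<bar> * \<bar>x j\<bar>) \<le> (x i)\<^sup>2 + (x j)\<^sup>2"
      using sum_squares_bound[of "\<bar>x i\<bar>" "\<bar>x j\<bar>"] by simp
    ultimately have "\<bar>x i\<bar> * \<bar>x j\<bar> \<le> ?S" by simp
    then have "\<bar>M i j\<bar> * (\<bar>x i\<bar> * \<bar>x j\<bar>) \<le> \<bar>M i j\<bar> * ?S" by (intro mult_left_mono) auto
    then show ?thesis by (simp add: abs_mult mult_ac)
  qed
  have "\<bar>bform d M x x\<bar> \<le> (\<Sum>i<d. \<Sum>j<d. \<bar>x i * M i j * x j\<bar>)"
    unfolding bform_def by (rule order.trans[OF sum_abs sum_mono[OF sum_abs]])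
  also have "\<dots> \<le> (\<Sum>i<d. \<Sum>j<d. \<bar>M i j\<bar> * ?S)" using le by (intro sum_mono) auto
  finally show ?thesis by (simp add: sum_distrib_right)
qed

lemma bform_shift:
  "bform d (\<lambda>i j. M i j - (if i = j then t else 0)) x x = bform d M x x - t * (\<Sum>i<d. (x i)\<^sup>2)"
proof -
  have "(\<Sum>j<d. x i * (M i j - (if i = j then t else 0)) * x j)
      = (\<Sum>j<d. x i * M i j * x j) - t * (x i)\<^sup>2" if "i < d" for i
  proof -
    have "(\<Sum>j<d. x i * (M i j - (if i = j then t else 0)) * x j)
      = (\<Sum>j<d. x i * M i j * x j - (if i = j then t * (x i)\<^sup>2 else 0))"
      by (intro sum.cong) (auto simp: algebra_simps power2_eq_square)
    then show ?thesis using that by (simp add: sum_subtractf)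
  qed
  then show ?thesis unfolding bform_def by (simp add: sum_subtractf sum_distrib_left)
qed

section \<open>Coercivity and the least eigenvalue of a symmetric matrix\<close>

text \<open>Positivity at \<open>x - s B x\<close> with \<open>s = 1 / K\<close> bounds \<open>\<bar>B x\<bar>\<^sup>2\<close> by \<open>K\<close> times the form at \<open>x\<close>.\<close>

lemma semidefinite_invertible_coercive:
  fixes B :: "real mat"
  assumes B: "B \<in> carrier_mat d d" and sym: "\<And>i j. i < d \<Longrightarrow> j < d \<Longrightarrow> B $$ (i, j) = B $$ (j, i)"
    and psd: "\<And>x. 0 \<le> bform d (\<lambda>i j. B $$ (i, j)) x x"
    and det: "Determinant.det B \<noteq> 0"
  obtains c where "c > 0" "\<And>x. c * (\<Sum>i<d. (x i)\<^sup>2) \<le> bform d (\<lambda>i j. B $$ (i, j)) x x"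
proof -
  let ?b = "bform d (\<lambda>i j. B $$ (i, j))"
  from det_non_zero_imp_unit[OF B det] obtain C where C: "C \<in> carrier_mat d d" and CB: "C * B = 1\<^sub>m d"
    by (auto simp: Units_def ring_mat_def)
  \<comment> \<open>\<open>K\<close> and \<open>L\<close> bound the forms of \<open>B\<close> and
    \<open>E\<close> through \<open>bform_abs_le\<close>; the added 1 keeps them positive.
    \<open>E\<close> is the transpose of \<open>C\<close> times \<open>C\<close>, so its form at
    \<open>y\<close> is the squared norm of \<open>C y\<close>.\<close>
  define K where "K = 1 + (\<Sum>i<d. \<Sum>j<d. \<bar>B $$ (i, j)\<bar>)"
  define E where "E = (\<lambda>j k. \<Sum>i<d. C $$ (i, j) * C $$ (i, k))"
  define L where "L = 1 + (\<Sum>i<d. \<Sum>j<d. \<bar>E i j\<bar>)"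
  have KL: "K > 0" "L > 0" unfolding K_def L_def by (smt (verit) abs_ge_zero sum_nonneg)+
  have "1 / (K * L) * (\<Sum>i<d. (x i)\<^sup>2) \<le> ?b x x" for x
  proof -
    define y where "y = (\<lambda>i. \<Sum>j<d. B $$ (i, j) * x j)"
    let ?Y = "\<Sum>i<d. (y i)\<^sup>2"
    have Y0: "0 \<le> ?Y" by (simp add: sum_nonneg)
    have byx: "?b y x = ?Y"
      by (simp add: bform_def y_def power2_eq_square sum_distrib_left mult_ac)
    have bxy: "?b x y = ?Y" using byx bform_commute[of d "\<lambda>i j. B $$ (i, j)"] sym by metis
    have "?b y y \<le> K * ?Y"
      using bform_abs_le[of d "\<lambda>i j. B $$ (i, j)" y] Y0 by (simp add: K_def distrib_right)
    \<comment> \<open>At \<open>s = 1 / K\<close> the quadratic term is at most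
      \<open>?Y / K\<close>, while the two mixed terms remove \<open>2 * ?Y / K\<close>; one
      \<open>?Y / K\<close> remains to be bounded by the form at \<open>x\<close>.\<close>
    then have "(1 / K)\<^sup>2 * ?b y y \<le> (1 / K)\<^sup>2 * (K * ?Y)" by (intro mult_left_mono) auto
    moreover have "(1 / K)\<^sup>2 * (K * ?Y) = 1 / K * ?Y" using KL by (simp add: power2_eq_square)
    moreover have "0 \<le> ?b x x - 1 / K * ?Y - 1 / K * ?Y + (1 / K)\<^sup>2 * ?b y y"
      using psd[of "\<lambda>i. x i - 1 / K * y i"] unfolding bform_diff_scale bxy byx .
    ultimately have 1: "1 / K * ?Y \<le> ?b x x" by linarith
    \<comment> \<open>The inverse \<open>C\<close> recovers \<open>x\<close> from \<open>y\<close>,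
      so the norm of \<open>x\<close> is controlled by that of \<open>y\<close>.\<close>
    have xi: "x i = (\<Sum>j<d. C $$ (i, j) * y j)" if i: "i < d" for i
    proof -
      have "(\<Sum>j<d. C $$ (i, j) * y j) = (\<Sum>k<d. \<Sum>j<d. C $$ (i, j) * B $$ (j, k) * x k)"
        unfolding y_def sum_distrib_left by (subst sum.swap) (simp add: mult_ac)
      also have "\<dots> = (\<Sum>k<d. (C * B) $$ (i, k) * x k)"
        using i B C by (intro sum.cong) (auto simp: scalar_prod_def atLeast0LessThan sum_distrib_right)
      also have "\<dots> = (\<Sum>k<d. if k = i then x i else 0)"
        unfolding CB using i by (intro sum.cong) auto
      finally show ?thesis using i by simp
    qed
    have "(\<Sum>i<d. (x i)\<^sup>2) = (\<Sum>i<d. \<Sum>j<d. \<Sum>k<d. y j * (C $$ (i, j) * C $$ (i, k)) * y k)"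
      by (intro sum.cong refl) (simp add: xi power2_eq_square sum_product mult_ac)
    also have "\<dots> = (\<Sum>j<d. \<Sum>i<d. \<Sum>k<d. y j * (C $$ (i, j) * C $$ (i, k)) * y k)"
      by (rule sum.swap)
    also have "\<dots> = (\<Sum>j<d. \<Sum>k<d. \<Sum>i<d. y j * (C $$ (i, j) * C $$ (i, k)) * y k)"
      by (intro sum.cong refl sum.swap)
    also have "\<dots> = bform d E y y"
      by (simp add: bform_def E_def sum_distrib_left sum_distrib_right)
    also have "\<dots> \<le> L * ?Y"
      using bform_abs_le[of d E y] Y0 by (simp add: L_def distrib_right)
    finally have "1 / (K * L) * (\<Sum>i<d. (x i)\<^sup>2) \<le> 1 / (K * L) * (L * ?Y)"
      using KL by (intro mult_left_mono) auto
    also have "\<dots> = 1 / K * ?Y" using KL by simp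
    finally show ?thesis using 1 by linarith
  qed
  moreover have "1 / (K * L) > 0" using KL by simp
  ultimately show ?thesis using that by blast
qed

text \<open>The supremum of all lower bounds of the form is an eigenvalue: otherwise coercivity of the
  shifted form would allow a larger lower bound.\<close>

lemma symmetric_least_eigenvalue:
  fixes M :: "real mat"
  assumes M: "M \<in> carrier_mat d d" and sym: "\<And>i j. i < d \<Longrightarrow> j < d \<Longrightarrow> M $$ (i, j) = M $$ (j, i)"
    and d: "d > 0"
  obtains t where "eigenvalue M t" "\<And>x. t * (\<Sum>i<d. (x i)\<^sup>2) \<le> bform d (\<lambda>i j. M $$ (i, j)) x x"
proof -
  let ?q = "\<lambda>x. bform d (\<lambda>i j. M $$ (i, j)) x x"
  let ?N = "\<lambda>x::nat \<Rightarrow> real. \<Sum>i<d. (x i)\<^sup>2"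
  define S where "S = {t. \<forall>x. t * ?N x \<le> ?q x}"
  have "- (\<Sum>i<d. \<Sum>j<d. \<bar>M $$ (i, j)\<bar>) \<in> S"
    unfolding S_def using bform_abs_le[of d "\<lambda>i j. M $$ (i, j)"] by (auto simp: abs_le_iff minus_le_iff)
  then have ne: "S \<noteq> {}" by blast
  have up: "s * ?N x \<le> ?q x" if "s \<in> S" for s x using that by (auto simp: S_def)
  \<comment> \<open>A unit vector, available because \<open>d > 0\<close>: its form value bounds
    \<open>S\<close> above.\<close>
  let ?u = "\<lambda>i. if i = 0 then 1 else 0 :: real"
  have "(\<Sum>i<d. (?u i)\<^sup>2) = (\<Sum>i<d. if i = 0 then 1 else 0)" by (intro sum.cong) auto
  then have u: "?N ?u = 1" using d by simp
  have bdd: "bdd_above S" using up[of _ ?u] u by (intro bdd_aboveI[of _ "?q ?u"]) simp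
  have SupS: "Sup S * ?N x \<le> ?q x" for x
  proof (cases "?N x = 0")
    case True
    then show ?thesis using up[of _ x] ne by fastforce
  next
    case False
    then have pos: "?N x > 0" by (metis less_eq_real_def sum_nonneg zero_le_power2)
    have "Sup S \<le> ?q x / ?N x"
      using up[of _ x] pos by (intro cSup_least[OF ne]) (simp add: pos_le_divide_eq)
    then show ?thesis using pos by (simp add: pos_le_divide_eq)
  qed
  have "eigenvalue M (Sup S)"
  proof (rule ccontr)
    assume "\<not> eigenvalue M (Sup S)"
    then have det: "Determinant.det (char_matrix M (Sup S)) \<noteq> 0" using eigenvalue_det[OF M] by blast
    \<comment> \<open>\<open>?B\<close> is \<open>M - Sup S * I\<close>: semidefinite by
      \<open>SupS\<close> and, if \<open>Sup S\<close> is no eigenvalue, invertible.\<close>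
    let ?B = "char_matrix M (Sup S)"
    have B: "?B \<in> carrier_mat d d" using M by simp
    have e: "?B $$ (i, j) = M $$ (i, j) - (if i = j then Sup S else 0)" if "i < d" "j < d" for i j
      using that M by (auto simp: char_matrix_def)
    have eb: "bform d (\<lambda>i j. ?B $$ (i, j)) x x = ?q x - Sup S * ?N x" for x
    proof -
      have "bform d (\<lambda>i j. ?B $$ (i, j)) x x = bform d (\<lambda>i j. M $$ (i, j) - (if i = j then Sup S else 0)) x x"
        unfolding bform_def by (intro sum.cong) (auto simp: e)
      then show ?thesis unfolding bform_shift .
    qed
    obtain c where c: "c > 0" "\<And>x. c * ?N x \<le> bform d (\<lambda>i j. ?B $$ (i, j)) x x"
    proof (rule semidefinite_invertible_coercive[OF B _ _ det])
      show "?B $$ (i, j) = ?B $$ (j, i)" if "i < d" "j < d" for i j using that sym e by simp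
      show "0 \<le> bform d (\<lambda>i j. ?B $$ (i, j)) x x" for x unfolding eb using SupS[of x] by simp
    qed blast
    have "(Sup S + c) * ?N x \<le> ?q x" for x using c(2)[of x] unfolding eb by (simp add: distrib_right)
    then have "Sup S + c \<in> S" by (simp add: S_def)
    from cSup_upper[OF this bdd] c show False by simp
  qed
  then show ?thesis using that SupS by blast
qed

text \<open>Splitting \<open>v\<close> into real and imaginary parts leaves two mixed terms, which
  cancel by symmetry. Complex eigenvectors thereby become accessible to bounds on real
  forms.\<close>

lemma hermitian_form_of_real:
  fixes v :: "nat \<Rightarrow> complex"
  assumes sym: "\<And>i j. i < d \<Longrightarrow> j < d \<Longrightarrow> M i j = M j i"
  shows "(\<Sum>i<d. \<Sum>j<d. cnj (v i) * of_real (M i j) * v j)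
    = of_real (bform d M (Re \<circ> v) (Re \<circ> v) + bform d M (Im \<circ> v) (Im \<circ> v))"
proof (rule complex_eqI)
  show "Re (\<Sum>i<d. \<Sum>j<d. cnj (v i) * of_real (M i j) * v j)
    = Re (of_real (bform d M (Re \<circ> v) (Re \<circ> v) + bform d M (Im \<circ> v) (Im \<circ> v)))"
    by (simp add: bform_def sum.distrib)
  have "Im (\<Sum>i<d. \<Sum>j<d. cnj (v i) * of_real (M i j) * v j)
    = bform d M (Re \<circ> v) (Im \<circ> v) - bform d M (Im \<circ> v) (Re \<circ> v)"
    by (simp add: bform_def sum.distrib sum_subtractf sum_negf)
  then show "Im (\<Sum>i<d. \<Sum>j<d. cnj (v i) * of_real (M i j) * v j)
    = Im (of_real (bform d M (Re \<circ> v) (Re \<circ> v) + bform d M (Im \<circ> v) (Im \<circ> v)))"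
    using bform_commute[OF sym] by simp
qed

text \<open>\<open>M\<close> need not be symmetric, so an eigenvector \<open>v\<close> is complex at
  first. Pairing \<open>G v = z D v\<close> with \<open>v\<close> exhibits \<open>z\<close> as a
  quotient of two real numbers: the form of \<open>G\<close> is at least \<open>\<mu>\<close> times
  the squared norm of \<open>v\<close>, that of \<open>D\<close> at most the squared norm.\<close>

lemma relative_eigenvalue_real:
  fixes G D M :: "real mat" and \<mu> :: real
  assumes M: "M \<in> carrier_mat d d" and D: "D \<in> carrier_mat d d" and G: "G = D * M"
    and symG: "\<And>i j. i < d \<Longrightarrow> j < d \<Longrightarrow> G $$ (i, j) = G $$ (j, i)"
    and symD: "\<And>i j. i < d \<Longrightarrow> j < d \<Longrightarrow> D $$ (i, j) = D $$ (j, i)"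
    and \<mu>: "\<mu> > 0" and lowG: "\<And>x. \<mu> * (\<Sum>i<d. (x i)\<^sup>2) \<le> bform d (\<lambda>i j. G $$ (i, j)) x x"
    and psdD: "\<And>x. 0 \<le> bform d (\<lambda>i j. D $$ (i, j)) x x"
    and uppD: "\<And>x. bform d (\<lambda>i j. D $$ (i, j)) x x \<le> (\<Sum>i<d. (x i)\<^sup>2)"
    and ev: "eigenvalue (map_mat complex_of_real M) z"
  shows "\<exists>x\<ge>\<mu>. z = of_real x"
proof -
  let ?c = "map_mat complex_of_real"
  let ?h = "\<lambda>A v. bform d (\<lambda>i j. A $$ (i, j)) (Re \<circ> v) (Re \<circ> v) + bform d (\<lambda>i j. A $$ (i, j)) (Im \<circ> v) (Im \<circ> v)"
  from ev obtain w where w: "w \<in> carrier_vec d" "w \<noteq> 0\<^sub>v d" "?c M *\<^sub>v w = z \<cdot>\<^sub>v w"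
    using M by (auto simp: eigenvalue_def eigenvector_def)
  define v where "v = (\<lambda>i. w $ i)"
  have "?c G *\<^sub>v w = ?c D *\<^sub>v (?c M *\<^sub>v w)"
    unfolding G of_real_hom.mat_hom_mult[OF D M] using M D w by simp
  then have Gw: "?c G *\<^sub>v w = ?c D *\<^sub>v (z \<cdot>\<^sub>v w)" by (simp only: w(3))
  have GD: "(\<Sum>j<d. of_real (G $$ (i, j)) * v j) = z * (\<Sum>j<d. of_real (D $$ (i, j)) * v j)" if "i < d" for i
  proof -
    have "(\<Sum>j<d. of_real (G $$ (i, j)) * v j) = (?c G *\<^sub>v w) $ i"
      using that w M D by (simp add: G v_def scalar_prod_def atLeast0LessThan)
    also have "\<dots> = z * (\<Sum>j<d. of_real (D $$ (i, j)) * v j)"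
      unfolding Gw using that w D by (simp add: v_def scalar_prod_def atLeast0LessThan sum_distrib_left mult_ac)
    finally show ?thesis .
  qed
  have "complex_of_real (?h G v) = (\<Sum>i<d. cnj (v i) * (\<Sum>j<d. of_real (G $$ (i, j)) * v j))"
    by (subst hermitian_form_of_real[symmetric]) (auto simp: symG sum_distrib_left mult.assoc)
  also have "\<dots> = (\<Sum>i<d. cnj (v i) * (z * (\<Sum>j<d. of_real (D $$ (i, j)) * v j)))"
    by (intro sum.cong) (simp_all add: GD)
  also have "\<dots> = z * (\<Sum>i<d. \<Sum>j<d. cnj (v i) * of_real (D $$ (i, j)) * v j)"
    by (simp add: sum_distrib_left mult_ac)
  also have "\<dots> = z * of_real (?h D v)"
    by (subst hermitian_form_of_real) (auto simp: symD)
  finally have eq: "complex_of_real (?h G v) = z * of_real (?h D v)" .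
  define s where "s = (\<Sum>i<d. ((Re \<circ> v) i)\<^sup>2) + (\<Sum>i<d. ((Im \<circ> v) i)\<^sup>2)"
  obtain i where i: "i < d" "v i \<noteq> 0"
    using w(1,2) unfolding v_def by (metis carrier_vecD eq_vecI index_zero_vec(1) index_zero_vec(2))
  have "0 < (cmod (v i))\<^sup>2" using i by simp
  also have "\<dots> \<le> (\<Sum>i<d. (cmod (v i))\<^sup>2)" using i by (intro member_le_sum) auto
  also have "\<dots> = s" by (simp add: s_def cmod_power2 sum.distrib)
  finally have s: "s > 0" .
  have hG: "\<mu> * s \<le> ?h G v" using lowG[of "Re \<circ> v"] lowG[of "Im \<circ> v"] by (simp add: s_def distrib_left)
  have hD: "0 \<le> ?h D v" "?h D v \<le> s"
    using psdD[of "Re \<circ> v"] psdD[of "Im \<circ> v"] uppD[of "Re \<circ> v"] uppD[of "Im \<circ> v"] by (simp_all add: s_def)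
  have "0 < \<mu> * s" using \<mu> s by simp
  \<comment> \<open>Through \<open>eq\<close> this excludes \<open>?h D v = 0\<close>, so
    semidefiniteness of \<open>D\<close> becomes strict positivity at \<open>v\<close>.\<close>
  then have "?h G v \<noteq> 0" using hG by linarith
  then have "?h D v \<noteq> 0" using eq by (metis mult_zero_right of_real_0 of_real_eq_iff)
  then have pos: "?h D v > 0" using hD by linarith
  have "z = of_real (?h G v / ?h D v)" using eq pos by (simp add: field_simps del: of_real_add)
  moreover have "\<mu> * ?h D v \<le> ?h G v" using hD hG \<mu> by (smt (verit) mult_left_mono)
  then have "\<mu> \<le> ?h G v / ?h D v" using pos by (simp add: pos_le_divide_eq)
  ultimately show ?thesis by blast
qed

lemma bform_eigenvector:
  fixes A :: "real mat"
  assumes "A \<in> carrier_mat d d" "w \<in> carrier_vec d" "A *\<^sub>v w = k \<cdot>\<^sub>v w"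
  shows "bform d (\<lambda>i j. A $$ (i, j)) (\<lambda>i. w $ i) (\<lambda>i. w $ i) = k * (\<Sum>i<d. (w $ i)\<^sup>2)"
proof -
  have "(\<Sum>j<d. A $$ (i, j) * w $ j) = k * w $ i" if "i < d" for i
  proof -
    have "(\<Sum>j<d. A $$ (i, j) * w $ j) = (A *\<^sub>v w) $ i"
      using that assms(1,2) by (simp add: scalar_prod_def atLeast0LessThan)
    then show ?thesis using that assms(2,3) by simp
  qed
  then have "(\<Sum>i<d. w $ i * (\<Sum>j<d. A $$ (i, j) * w $ j)) = (\<Sum>i<d. w $ i * (k * w $ i))"
    by (intro sum.cong) auto
  then show ?thesis
    by (simp add: bform_def sum_distrib_left power2_eq_square mult_ac)
qed

lemma sum_squares_vec_pos:
  fixes w :: "real vec"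
  assumes "w \<in> carrier_vec d" "w \<noteq> 0\<^sub>v d"
  shows "0 < (\<Sum>i<d. (w $ i)\<^sup>2)"
proof -
  obtain i where i: "i < d" "w $ i \<noteq> 0"
    using assms by (metis carrier_vecD eq_vecI index_zero_vec(1) index_zero_vec(2))
  then have "0 < (w $ i)\<^sup>2" by simp
  also have "\<dots> \<le> (\<Sum>i<d. (w $ i)\<^sup>2)" using i by (intro member_le_sum) auto
  finally show ?thesis .
qed

text \<open>Cutting \<open>x\<close> into its pieces on the fibres of \<open>f\<close> reduces a
  block-diagonal form to values of the full form of \<open>M\<close>, so a sign of the latter passes
  to the block-diagonal part.\<close>

lemma bform_blocks:
  fixes f :: "nat \<Rightarrow> nat"
  assumes "\<And>a. a < d \<Longrightarrow> f a < N"
  shows "bform d (\<lambda>a b. if f a = f b then M a b else 0) x x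
    = (\<Sum>k<N. bform d M (\<lambda>a. if f a = k then x a else 0) (\<lambda>a. if f a = k then x a else 0))"
proof -
  have "(\<Sum>k<N. (if f a = k then x a else 0) * M a b * (if f b = k then x b else 0))
      = x a * (if f a = f b then M a b else 0) * x b" if "a < d" for a b
  proof -
    have "(\<Sum>k<N. (if f a = k then x a else 0) * M a b * (if f b = k then x b else 0))
      = (\<Sum>k<N. if k = f a then x a * (if f a = f b then M a b else 0) * x b else 0)"
      by (intro sum.cong) auto
    then show ?thesis using assms[OF that] by simp
  qed
  then have "bform d (\<lambda>a b. if f a = f b then M a b else 0) x x
    = (\<Sum>a<d. \<Sum>b<d. \<Sum>k<N. (if f a = k then x a else 0) * M a b * (if f b = k then x b else 0))"
    unfolding bform_def by (intro sum.cong) auto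
  also have "\<dots> = (\<Sum>a<d. \<Sum>k<N. \<Sum>b<d. (if f a = k then x a else 0) * M a b * (if f b = k then x b else 0))"
    by (intro sum.cong refl sum.swap)
  also have "\<dots> = (\<Sum>k<N. \<Sum>a<d. \<Sum>b<d. (if f a = k then x a else 0) * M a b * (if f b = k then x b else 0))"
    by (rule sum.swap)
  finally show ?thesis unfolding bform_def .
qed

text \<open>The form of a multiple of the all-ones matrix never has the sign opposite to
  \<open>c\<close>; this handles the \<open>J / n\<close> in the diagonal blocks.\<close>

lemma bform_const: "bform d (\<lambda>_ _. c) x x = c * (\<Sum>i<d. x i)\<^sup>2"
  by (simp add: bform_def power2_eq_square sum_product sum_distrib_left mult_ac)

section \<open>Transition probabilities and the Gram matrix\<close>

text \<open>With \<open>N = n + 1\<close> and \<open>m = n - 1\<close> this decodes row numbers into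
  pairs of a basis and a position.\<close>

lemma sum_lessThan_mult:
  fixes f :: "nat \<Rightarrow> 'a::comm_monoid_add"
  shows "(\<Sum>a<N * m. f a) = (\<Sum>k<N. \<Sum>i<m. f (k * m + i))"
proof -
  have "sum f {k * m..<k * m + m} = (\<Sum>i<m. f (k * m + i))" for k
    using sum.shift_bounds_nat_ivl[of f 0 "k * m" m] by (simp add: atLeast0LessThan add.commute)
  then show ?thesis by (simp flip: sum.nat_group)
qed

lemma transition_prob_commute:
  assumes "cvec.dim (UNIV :: 'a::complex_inner_space set) = n" "csmb n (\<alpha> :: nat \<Rightarrow> nat \<Rightarrow> 'a)"
  shows "transition_prob \<alpha> k l i j = transition_prob \<alpha> l k j i"
  unfolding transition_prob_eq[OF assms] by (subst cinner_commute) simp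

lemma transition_prob_same:
  assumes "cvec.dim (UNIV :: 'a::complex_inner_space set) = n" "csmb n (\<alpha> :: nat \<Rightarrow> nat \<Rightarrow> 'a)"
    and "k < n + 1" "i < n" "j < n"
  shows "transition_prob \<alpha> k k i j = (if i = j then 1 else 0)"
  unfolding transition_prob_eq[OF assms(1,2)]
  using assms(2-) by (auto simp: csmb_def orthonormal_basis_def)

text \<open>Parseval in basis \<open>k\<close> for the unit vector
  \<open>\<alpha> l j\<close>.\<close>

lemma sum_transition_prob:
  assumes "cvec.dim (UNIV :: 'a::complex_inner_space set) = n" "csmb n (\<alpha> :: nat \<Rightarrow> nat \<Rightarrow> 'a)"
    and "k < n + 1" "l < n + 1" "j < n"
  shows "(\<Sum>i<n. transition_prob \<alpha> k l i j) = 1"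
proof -
  have o: "orthonormal_basis n (\<alpha> k)" "orthonormal_basis n (\<alpha> l)" using assms by (auto simp: csmb_def)
  let ?x = "\<alpha> l j"
  have "of_real (transition_prob \<alpha> k l i j) = cinner ?x (\<alpha> k i) * cinner (\<alpha> k i) ?x" for i
    unfolding transition_prob_eq[OF assms(1,2)]
    by (subst (2) cinner_commute) (simp only: complex_norm_square mult.commute)
  then have "complex_of_real (\<Sum>i<n. transition_prob \<alpha> k l i j) = cinner ?x ?x"
    using parseval[OF o(1), of ?x ?x] by simp
  also have "\<dots> = 1" using o(2) assms(5) by (simp add: orthonormal_basis_def)
  finally show ?thesis using of_real_eq_1_iff by blast
qed

lemma cinner_sum_left: "cinner (\<Sum>i\<in>A. f i) x = (\<Sum>i\<in>A. cinner (f i :: 'a::complex_inner_space) x)"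
  by (induction A rule: infinite_finite_induct) (auto simp: cinner_add_left)

lemma traceless_proj_selfadjoint:
  "cinner (traceless_proj n a u) v = cinner u (traceless_proj n a (v::'a::complex_inner_space))"
  by (simp add: traceless_proj_def proj1_def cinner_diff_left cinner_diff_right
     cinner_scaleC_left cinner_scaleC_right flip: cinner_commute)

lemma cinner_ge_0: "0 \<le> Re (cinner x (x::'a::complex_inner_space))"
  using cinner_pos[of x] by (cases "x = 0") auto

lemma square_minus_one_nat: "(n::nat)\<^sup>2 - 1 = (n + 1) * (n - 1)"
  by (cases n) (auto simp: power2_eq_square)

lemma index_bounds:
  fixes n a :: nat
  assumes "n \<ge> 2" "a < n\<^sup>2 - 1"
  shows "a div (n - 1) < n + 1" "a mod (n - 1) < n - 1" "a mod (n - 1) < n"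
proof -
  show "a div (n - 1) < n + 1"
    using assms(2) unfolding square_minus_one_nat by (rule less_mult_imp_div_less)
  show *: "a mod (n - 1) < n - 1" using assms by simp
  then show "a mod (n - 1) < n" by linarith
qed

section \<open>Positive definiteness of the Gram matrix\<close>

text \<open>The form is \<open>Tr (S\<^sup>\<dagger> S)\<close> for \<open>S = \<Sum>a. x a T\<^sub>a\<close>.\<close>

lemma gram_positive_definite:
  assumes dim: "cvec.dim (UNIV :: 'a::complex_inner_space set) = n" and c: "csmb n (\<alpha> :: nat \<Rightarrow> nat \<Rightarrow> 'a)"
    and n: "n \<ge> 2"
  shows gram_form_nonneg: "0 \<le> bform (n\<^sup>2 - 1) (\<lambda>a b. gram n \<alpha> $$ (a, b)) x x"
    and gram_form_zero: "bform (n\<^sup>2 - 1) (\<lambda>a b. gram n \<alpha> $$ (a, b)) x x = 0 \<Longrightarrow> a < n\<^sup>2 - 1 \<Longrightarrow> x a = 0"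
proof -
  have "orthonormal_basis n (\<alpha> 0)" using c by (simp add: csmb_def)
  from ctrace_orthonormal_basis[OF dim this] obtain e :: "nat \<Rightarrow> 'a" where e: "orthonormal_basis n e"
    and t: "\<And>A :: 'a \<Rightarrow> 'a. ctrace A = (\<Sum>i<n. cinner (e i) (A (e i)))" by metis
  define d where "d = n\<^sup>2 - 1"
  define T where "T = (\<lambda>a. traceless_proj n (\<alpha> (a div (n - 1)) (a mod (n - 1))))"
  define S where "S = (\<lambda>v. \<Sum>a<d. of_real (x a) *\<^sub>C T a v)"
  have T: "cinner (T a u) v = cinner u (T a v)" for a u v
    by (simp add: T_def traceless_proj_selfadjoint)
  have S: "cinner (S u) v = cinner u (S v)" for u v
    by (simp add: S_def cinner_sum_left cinner_sum_right cinner_scaleC_left cinner_scaleC_right T)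
  \<comment> \<open>Self-adjointness turns each entry into a sum of inner products of
    \<open>T a (e r)\<close> with \<open>T b (e r)\<close>, which makes the whole form the sum of
    the squared norms of the \<open>S (e r)\<close>.\<close>
  have G: "gram n \<alpha> $$ (a, b) = (\<Sum>r<n. Re (cinner (T a (e r)) (T b (e r))))" if "a < d" "b < d" for a b
    using that by (simp add: gram_def d_def hs_inner_def cadjoint_traceless_proj t T_def traceless_proj_selfadjoint)
  have "bform d (\<lambda>a b. gram n \<alpha> $$ (a, b)) x x
      = (\<Sum>a<d. \<Sum>b<d. \<Sum>r<n. x a * Re (cinner (T a (e r)) (T b (e r))) * x b)"
    unfolding bform_def by (intro sum.cong refl) (simp add: G sum_distrib_left sum_distrib_right)
  also have "\<dots> = (\<Sum>a<d. \<Sum>r<n. \<Sum>b<d. x a * Re (cinner (T a (e r)) (T b (e r))) * x b)"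
    by (intro sum.cong refl sum.swap)
  also have "\<dots> = (\<Sum>r<n. \<Sum>a<d. \<Sum>b<d. x a * Re (cinner (T a (e r)) (T b (e r))) * x b)"
    by (rule sum.swap)
  also have "\<dots> = (\<Sum>r<n. Re (cinner (S (e r)) (S (e r))))"
  proof (rule sum.cong)
    fix r
    have "cinner (S u) (S u) = (\<Sum>a<d. \<Sum>b<d. of_real (x a) * (of_real (x b) * cinner (T a u) (T b u)))" for u
      unfolding S_def cinner_sum_left
      by (simp add: cinner_sum_right cinner_scaleC_left cinner_scaleC_right sum_distrib_left mult.left_commute)
    then show "(\<Sum>a<d. \<Sum>b<d. x a * Re (cinner (T a (e r)) (T b (e r))) * x b) = Re (cinner (S (e r)) (S (e r)))"
      by (simp add: mult_ac)
  qed simp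
  finally have form: "bform d (\<lambda>a b. gram n \<alpha> $$ (a, b)) x x = (\<Sum>r<n. Re (cinner (S (e r)) (S (e r))))" .
  then show "0 \<le> bform (n\<^sup>2 - 1) (\<lambda>a b. gram n \<alpha> $$ (a, b)) x x"
    unfolding d_def[symmetric] by (simp add: sum_nonneg cinner_ge_0)
  assume z: "bform (n\<^sup>2 - 1) (\<lambda>a b. gram n \<alpha> $$ (a, b)) x x = 0" and a: "a < n\<^sup>2 - 1"
  have "\<forall>r\<in>{..<n}. Re (cinner (S (e r)) (S (e r))) = 0"
    using z form unfolding d_def[symmetric] by (simp add: sum_nonneg_eq_0_iff cinner_ge_0)
  then have Se: "S (e r) = 0" if "r < n" for r
    using that cinner_pos[of "S (e r)"] by force
  \<comment> \<open>The inner product of \<open>e r\<close> with \<open>S v\<close> equals that of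
    \<open>S (e r)\<close> with \<open>v\<close>, so \<open>S v\<close> is orthogonal to the whole
    basis.\<close>
  have "S v = 0" for v
  proof -
    have "cinner (e r) (S v) = 0" if "r < n" for r
      using Se[OF that] S[of "e r" v] by simp
    then show ?thesis using orthonormal_basis_expand[OF e, of "S v"] by simp
  qed
  \<comment> \<open>Regrouping row numbers into pairs \<open>(k, i)\<close> gives exactly the family
    whose independence \<open>csmb\<close> asserts.\<close>
  moreover have "S v = (\<Sum>k<n + 1. \<Sum>i<n - 1. of_real (x (k * (n - 1) + i)) *\<^sub>C traceless_proj n (\<alpha> k i) v)" for v
    unfolding S_def d_def square_minus_one_nat sum_lessThan_mult T_def by (intro sum.cong refl) simp
  ultimately have "\<forall>v. (\<Sum>k<n + 1. \<Sum>i<n - 1.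
      of_real (x (k * (n - 1) + i)) *\<^sub>C traceless_proj n (\<alpha> k i) v) = 0" by (simp only: simp_thms)
  then have "\<forall>k<n + 1. \<forall>i<n - 1. x (k * (n - 1) + i) = 0"
    by (rule c[unfolded csmb_def, THEN conjunct2, THEN spec[of _ "\<lambda>k i. x (k * (n - 1) + i)"], THEN mp])
  with index_bounds[OF n a] have "x (a div (n - 1) * (n - 1) + a mod (n - 1)) = 0" by blast
  then show "x a = 0" unfolding div_mult_mod_eq .
qed

text \<open>A kernel vector makes the form vanish and is therefore zero by
  \<open>gram_form_zero\<close>.\<close>

lemma det_gram_nonzero:
  assumes "cvec.dim (UNIV :: 'a::complex_inner_space set) = n" "csmb n (\<alpha> :: nat \<Rightarrow> nat \<Rightarrow> 'a)" "n \<ge> 2"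
  shows "Determinant.det (gram n \<alpha>) \<noteq> 0"
proof
  have G: "gram n \<alpha> \<in> carrier_mat (n\<^sup>2 - 1) (n\<^sup>2 - 1)" by (simp add: gram_def)
  assume "Determinant.det (gram n \<alpha>) = 0"
  then obtain w where w: "w \<in> carrier_vec (n\<^sup>2 - 1)" "w \<noteq> 0\<^sub>v (n\<^sup>2 - 1)" "gram n \<alpha> *\<^sub>v w = 0\<^sub>v (n\<^sup>2 - 1)"
    using det_0_iff_vec_prod_zero[OF G] by blast
  then have "gram n \<alpha> *\<^sub>v w = 0 \<cdot>\<^sub>v w" by auto
  from bform_eigenvector[OF G w(1) this] gram_form_zero[OF assms]
  have "\<And>a. a < n\<^sup>2 - 1 \<Longrightarrow> w $ a = 0" by simp
  then show False using sum_squares_vec_pos[OF w(1,2)] by simp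
qed

section \<open>Factoring out the block-diagonal part\<close>

text \<open>The quotient of the Gram matrix by its block diagonal part is explicit, since the inverse
  of \<open>I - J / n\<close> of order \<open>n - 1\<close> is \<open>I + J\<close>, where \<open>J\<close> is the all-ones matrix.\<close>

definition gram_quotient :: "nat \<Rightarrow> (nat \<Rightarrow> nat \<Rightarrow> 'a::complex_inner_space) \<Rightarrow> real mat" where
  "gram_quotient n \<alpha> = mat (n\<^sup>2 - 1) (n\<^sup>2 - 1) (\<lambda>(a, b).
     let m = n - 1 in
     if a div m = b div m then (if a = b then 1 else 0)
     else transition_prob \<alpha> (a div m) (b div m) (a mod m) (b mod m)
        - transition_prob \<alpha> (a div m) (b div m) m (b mod m))"

lemma gram_index:
  assumes "cvec.dim (UNIV :: 'a::complex_inner_space set) = n" "csmb n (\<alpha> :: nat \<Rightarrow> nat \<Rightarrow> 'a)" "n \<ge> 2"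
    and "a < n\<^sup>2 - 1" "b < n\<^sup>2 - 1"
  shows "gram n \<alpha> $$ (a, b) =
    transition_prob \<alpha> (a div (n - 1)) (b div (n - 1)) (a mod (n - 1)) (b mod (n - 1)) - 1 / real n"
  using assms(4,5) hs_inner_traceless_proj[OF assms(1,2)] index_bounds[OF assms(3,4)] index_bounds[OF assms(3,5)]
  by (simp add: gram_def)

text \<open>Orthonormality makes every diagonal block equal to \<open>I - J / n\<close>, whichever
  basis it belongs to.\<close>

lemma gram_diag_index:
  assumes "cvec.dim (UNIV :: 'a::complex_inner_space set) = n" "csmb n (\<alpha> :: nat \<Rightarrow> nat \<Rightarrow> 'a)" "n \<ge> 2"
    and "a < n\<^sup>2 - 1" "b < n\<^sup>2 - 1"
  shows "gram_diag n \<alpha> $$ (a, b) =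
    (if a div (n - 1) = b div (n - 1) then (if a = b then 1 else 0) - 1 / real n else 0)"
proof -
  have "a = b \<longleftrightarrow> a div (n - 1) = b div (n - 1) \<and> a mod (n - 1) = b mod (n - 1)"
    by (metis div_mult_mod_eq)
  then show ?thesis
    using assms(4,5) transition_prob_same[OF assms(1,2)] index_bounds[OF assms(3,4)] index_bounds[OF assms(3,5)]
    by (auto simp: gram_diag_def gram_index[OF assms])
qed

text \<open>Row \<open>a\<close> of the left factor meets a single block, so the product entry is
  the entry of the quotient minus \<open>1 / n\<close> times the column sum over that block. The
  column sum is 1 in a diagonal block; elsewhere it is \<open>1 - n s\<close> with \<open>s\<close>
  the transition probability at the omitted index \<open>n - 1\<close>, because a full column of
  transition probabilities sums to 1.\<close>

lemma gram_diag_mult_quotient: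
  assumes dim: "cvec.dim (UNIV :: 'a::complex_inner_space set) = n" and c: "csmb n (\<alpha> :: nat \<Rightarrow> nat \<Rightarrow> 'a)"
    and n: "n \<ge> 2"
  shows "gram n \<alpha> = gram_diag n \<alpha> * gram_quotient n \<alpha>"
proof (rule eq_matI)
  let ?s = "transition_prob \<alpha>"
  define m where "m = n - 1"
  define d where "d = n\<^sup>2 - 1"
  note index = gram_index[OF dim c n, folded m_def d_def] gram_diag_index[OF dim c n, folded m_def d_def]
  have quotient: "gram_quotient n \<alpha> $$ (a, b) = (if a div m = b div m then (if a = b then 1 else 0)
      else ?s (a div m) (b div m) (a mod m) (b mod m) - ?s (a div m) (b div m) m (b mod m))"
    if "a < d" "b < d" for a b
    using that by (simp add: gram_quotient_def Let_def m_def d_def)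
  have dm: "d = (n + 1) * m" unfolding d_def m_def by (rule square_minus_one_nat)
  fix a b assume "a < dim_row (gram_diag n \<alpha> * gram_quotient n \<alpha>)"
    "b < dim_col (gram_diag n \<alpha> * gram_quotient n \<alpha>)"
  then have ab: "a < d" "b < d" by (auto simp: gram_diag_def gram_quotient_def d_def)
  let ?k = "a div m" and ?i = "a mod m" and ?l = "b div m" and ?j = "b mod m"
  have ia: "?k < n + 1" "?i < m" "?i < n" and ib: "?l < n + 1" "?j < m" "?j < n"
    using index_bounds[OF n] ab by (simp_all add: m_def d_def)
  have m: "m > 0" "n = Suc m" using n by (simp_all add: m_def)
  have lt: "k * m + i < d" if "k < n + 1" "i < m" for k i
  proof -
    have "k * m + i < Suc k * m" using that by simp
    also have "\<dots> \<le> (n + 1) * m" using that by (intro mult_le_mono) auto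
    finally show ?thesis unfolding dm .
  qed
  have eq: "a = ?k * m + i \<longleftrightarrow> i = ?i" if "i < m" for i
    by (metis div_mult_mod_eq add_left_cancel)
  have "(gram_diag n \<alpha> * gram_quotient n \<alpha>) $$ (a, b)
      = (\<Sum>c<d. gram_diag n \<alpha> $$ (a, c) * gram_quotient n \<alpha> $$ (c, b))"
    using ab by (simp add: gram_diag_def gram_quotient_def d_def scalar_prod_def atLeast0LessThan)
  also have "\<dots> = (\<Sum>k<n + 1. \<Sum>i<m. gram_diag n \<alpha> $$ (a, k * m + i) * gram_quotient n \<alpha> $$ (k * m + i, b))"
    unfolding dm sum_lessThan_mult ..
  also have "\<dots> = (\<Sum>k<n + 1. if k = ?k then
      (\<Sum>i<m. ((if i = ?i then 1 else 0) - 1 / real n) * gram_quotient n \<alpha> $$ (?k * m + i, b)) else 0)"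
  proof (intro sum.cong refl)
    fix k assume k: "k \<in> {..<n + 1}"
    have "gram_diag n \<alpha> $$ (a, k * m + i) = (if k = ?k then (if i = ?i then 1 else 0) - 1 / real n else 0)"
      if "i < m" for i
      using index(2)[OF ab(1) lt[of k i]] k that eq[OF that] by auto
    then show "(\<Sum>i<m. gram_diag n \<alpha> $$ (a, k * m + i) * gram_quotient n \<alpha> $$ (k * m + i, b)) =
      (if k = ?k then
        (\<Sum>i<m. ((if i = ?i then 1 else 0) - 1 / real n) * gram_quotient n \<alpha> $$ (?k * m + i, b)) else 0)"
      by simp
  qed
  also have "\<dots> = (\<Sum>i<m. ((if i = ?i then 1 else 0) - 1 / real n) * gram_quotient n \<alpha> $$ (?k * m + i, b))"
    using ia by simp
  also have "\<dots> = (\<Sum>i<m. (if i = ?i then gram_quotient n \<alpha> $$ (?k * m + i, b) else 0)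
      - 1 / real n * gram_quotient n \<alpha> $$ (?k * m + i, b))"
    by (intro sum.cong refl) (simp add: left_diff_distrib)
  also have "\<dots> = gram_quotient n \<alpha> $$ (a, b) - 1 / real n * (\<Sum>i<m. gram_quotient n \<alpha> $$ (?k * m + i, b))"
    using ia(2) by (simp add: sum_subtractf sum_distrib_left)
  also have "\<dots> = gram n \<alpha> $$ (a, b)"
  proof (cases "?k = ?l")
    case True
    have "(\<Sum>i<m. gram_quotient n \<alpha> $$ (?k * m + i, b)) = (\<Sum>i<m. if i = ?j then 1 else 0)"
    proof (rule sum.cong)
      fix i assume "i \<in> {..<m}"
      moreover from this have "?k * m + i = b \<longleftrightarrow> i = ?j" unfolding True by (metis div_mult_mod_eq add_left_cancel lessThan_iff)
      ultimately show "gram_quotient n \<alpha> $$ (?k * m + i, b) = (if i = ?j then 1 else 0)"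
        using True ab(2) lt[OF ia(1)] m(1) by (auto simp: quotient)
    qed simp
    then have "(\<Sum>i<m. gram_quotient n \<alpha> $$ (?k * m + i, b)) = 1" using ib(2) by simp
    moreover have "a = b \<longleftrightarrow> ?i = ?j" using True by (metis div_mult_mod_eq)
    ultimately show ?thesis
      using True ab transition_prob_same[OF dim c ia(1,3) ib(3)]
      by (simp add: index(1) quotient)
  next
    case False
    have "(\<Sum>i<m. gram_quotient n \<alpha> $$ (?k * m + i, b)) = (\<Sum>i<m. ?s ?k ?l i ?j - ?s ?k ?l m ?j)"
      using False ab(2) lt[OF ia(1)] m(1) by (intro sum.cong) (auto simp: quotient)
    \<comment> \<open>The omitted index \<open>m = n - 1\<close> joins the sum, which turns the
      \<open>m\<close> subtracted copies of its term into \<open>n\<close>.\<close>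
    also have "\<dots> = (\<Sum>i<Suc m. ?s ?k ?l i ?j) - real n * ?s ?k ?l m ?j"
      using m by (simp add: sum_subtractf algebra_simps)
    also have "\<dots> = 1 - real n * ?s ?k ?l m ?j"
      using sum_transition_prob[OF dim c ia(1) ib(1,3)] m by simp
    finally show ?thesis
      using False ab n by (simp add: index(1) quotient field_simps)
  qed
  finally show "gram n \<alpha> $$ (a, b) = (gram_diag n \<alpha> * gram_quotient n \<alpha>) $$ (a, b)" ..
qed (auto simp: gram_def gram_diag_def gram_quotient_def)

text \<open>From below, each block form is the Gram form at a restricted vector. From above, the
  blocks are \<open>I - J / n\<close> and \<open>J\<close> is positive semidefinite.\<close>

lemma gram_diag_form_bounds:
  assumes "cvec.dim (UNIV :: 'a::complex_inner_space set) = n" "csmb n (\<alpha> :: nat \<Rightarrow> nat \<Rightarrow> 'a)" "n \<ge> 2"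
  shows gram_diag_form_nonneg: "0 \<le> bform (n\<^sup>2 - 1) (\<lambda>a b. gram_diag n \<alpha> $$ (a, b)) x x"
    and gram_diag_form_le: "bform (n\<^sup>2 - 1) (\<lambda>a b. gram_diag n \<alpha> $$ (a, b)) x x \<le> (\<Sum>a<n\<^sup>2 - 1. (x a)\<^sup>2)"
proof -
  let ?d = "n\<^sup>2 - 1" and ?f = "\<lambda>a. a div (n - 1)"
  have blocks: "bform ?d (\<lambda>a b. if ?f a = ?f b then M a b else 0) x x
    = (\<Sum>k<n + 1. bform ?d M (\<lambda>a. if ?f a = k then x a else 0) (\<lambda>a. if ?f a = k then x a else 0))" for M
    by (rule bform_blocks) (rule index_bounds(1)[OF assms(3)])
  have "bform ?d (\<lambda>a b. gram_diag n \<alpha> $$ (a, b)) x x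
      = bform ?d (\<lambda>a b. if ?f a = ?f b then gram n \<alpha> $$ (a, b) else 0) x x"
    unfolding bform_def by (intro sum.cong refl) (simp add: gram_diag_def)
  also have "\<dots> \<ge> 0"
    unfolding blocks by (intro sum_nonneg gram_form_nonneg[OF assms])
  finally show "0 \<le> bform ?d (\<lambda>a b. gram_diag n \<alpha> $$ (a, b)) x x" .
  \<comment> \<open>Written as a shift by \<open>- 1\<close>, so that \<open>bform_shift\<close>
    splits off the identity.\<close>
  have "bform ?d (\<lambda>a b. gram_diag n \<alpha> $$ (a, b)) x x
      = bform ?d (\<lambda>a b. (if ?f a = ?f b then - (1 / real n) else 0) - (if a = b then - 1 else 0)) x x"
    unfolding bform_def by (intro sum.cong refl) (simp add: gram_diag_index[OF assms])
  also have "\<dots> = bform ?d (\<lambda>a b. if ?f a = ?f b then - (1 / real n) else 0) x x + (\<Sum>a<?d. (x a)\<^sup>2)"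
    unfolding bform_shift by simp
  also have "bform ?d (\<lambda>a b. if ?f a = ?f b then - (1 / real n) else 0) x x \<le> 0"
    unfolding blocks bform_const by (intro sum_nonpos) simp
  finally show "bform ?d (\<lambda>a b. gram_diag n \<alpha> $$ (a, b)) x x \<le> (\<Sum>a<?d. (x a)\<^sup>2)" by simp
qed

theorem theorem2:
  fixes n :: nat
    and \<alpha> :: "nat \<Rightarrow> nat \<Rightarrow> 'a::complex_inner_space"
    and \<epsilon> lambda_m :: real
    and \<Gamma>' :: "real mat"
  assumes "n \<ge> 2"
    and "cvec.dim (UNIV :: 'a set) = n"
    and "csmb n \<alpha>"
    and "\<epsilon> > 0"
    and "\<And>k l i j r. k < n + 1 \<Longrightarrow> l < n + 1 \<Longrightarrow> k \<noteq> l \<Longrightarrow> i < n \<Longrightarrow> j < n \<Longrightarrow> r < n \<Longrightarrow>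
           \<bar>transition_prob \<alpha> k l i j - transition_prob \<alpha> k l i r\<bar> < \<epsilon>"
    and "\<Gamma>' = gram n \<alpha> - 1\<^sub>m (n\<^sup>2 - 1)"
    and "lambda_m = Min (spectrum \<Gamma>')"
  shows "exp (((real n)\<^sup>2 - real n)\<^sup>2 * ((real n)\<^sup>2 - 1) * \<epsilon>\<^sup>2 / (1 + lambda_m))
           * (Determinant.det (gram n \<alpha>) / Determinant.det (gram_diag n \<alpha>)) \<ge> 1"
proof -
  note hyp = assms(2,3,1)
  define d where "d = n\<^sup>2 - 1"
  define \<mu> where "\<mu> = 1 + lambda_m"
  let ?G = "gram n \<alpha>" and ?D = "gram_diag n \<alpha>" and ?M = "gram_quotient n \<alpha>"
  have G: "?G \<in> carrier_mat d d" and D: "?D \<in> carrier_mat d d" and M: "?M \<in> carrier_mat d d"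
    by (simp_all add: gram_def gram_diag_def gram_quotient_def d_def)
  \<comment> \<open>This rules out truncation in \<open>n\<^sup>2 - 1\<close>, for the sign of
    \<open>d\<close> and for its conversion to a real.\<close>
  have "2\<^sup>2 \<le> n\<^sup>2" using assms(1) by (rule power_mono) simp
  then have d0: "d > 0" and dreal: "real d = (real n)\<^sup>2 - 1" by (simp_all add: d_def of_nat_diff)
  have symG: "?G $$ (a, b) = ?G $$ (b, a)" if "a < d" "b < d" for a b
    using that transition_prob_commute[OF assms(2,3)] by (simp add: gram_index[OF hyp] d_def)
  have symD: "?D $$ (a, b) = ?D $$ (b, a)" if "a < d" "b < d" for a b
    using that by (auto simp: gram_diag_index[OF hyp] d_def)
  have GM: "?G = ?D * ?M" by (rule gram_diag_mult_quotient[OF hyp])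

  \<comment> \<open>The least eigenvalue of the Gram matrix\<close>
  have \<Gamma>: "\<Gamma>' \<in> carrier_mat d d" unfolding assms(6) d_def[symmetric] by (rule minus_carrier_mat) simp
  have \<Gamma>i: "\<Gamma>' $$ (a, b) = ?G $$ (a, b) - (if a = b then 1 else 0)" if "a < d" "b < d" for a b
    using that G by (auto simp: assms(6) d_def)
  have shift: "bform d (\<lambda>a b. \<Gamma>' $$ (a, b)) x x = bform d (\<lambda>a b. ?G $$ (a, b)) x x - (\<Sum>a<d. (x a)\<^sup>2)" for x
  proof -
    have "bform d (\<lambda>a b. \<Gamma>' $$ (a, b)) x x = bform d (\<lambda>a b. ?G $$ (a, b) - (if a = b then 1 else 0)) x x"
      unfolding bform_def by (intro sum.cong refl) (simp add: \<Gamma>i)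
    then show ?thesis by (simp add: bform_shift)
  qed
  obtain t where t: "eigenvalue \<Gamma>' t" "\<And>x. t * (\<Sum>a<d. (x a)\<^sup>2) \<le> bform d (\<lambda>a b. \<Gamma>' $$ (a, b)) x x"
    using symmetric_least_eigenvalue[OF \<Gamma> _ d0] symG by (smt (verit) \<Gamma>i)
  have fin: "finite (spectrum \<Gamma>')" by (rule card_finite_spectrum[OF \<Gamma>])
  have tspec: "t \<in> spectrum \<Gamma>'" using t(1) by (simp add: spectrum_def)
  \<comment> \<open>\<open>t\<close> is a lower bound of the form of \<open>\<Gamma>'\<close>, so
    the smaller \<open>lambda_m\<close> is one too; undoing the shift by the identity makes
    \<open>\<mu>\<close> a lower bound of the Gram form.\<close>
  have "lambda_m \<le> t" unfolding assms(7) using fin tspec by (rule Min_le)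
  then have low: "\<mu> * (\<Sum>a<d. (x a)\<^sup>2) \<le> bform d (\<lambda>a b. ?G $$ (a, b)) x x" for x
    using t(2)[of x] mult_right_mono[of lambda_m t "\<Sum>a<d. (x a)\<^sup>2"]
    by (simp add: shift \<mu>_def distrib_right sum_nonneg)
  \<comment> \<open>The spectrum contains \<open>t\<close>, so \<open>Min\<close> is taken over a
    nonempty finite set and is attained; at its eigenvector positive definiteness yields
    \<open>\<mu> > 0\<close>.\<close>
  have "lambda_m \<in> spectrum \<Gamma>'" unfolding assms(7) using fin tspec by (intro Min_in) auto
  then obtain w where w: "w \<in> carrier_vec d" "w \<noteq> 0\<^sub>v d" "\<Gamma>' *\<^sub>v w = lambda_m \<cdot>\<^sub>v w"
    using \<Gamma> by (auto simp: spectrum_def eigenvalue_def eigenvector_def)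
  have pos: "0 < (\<Sum>a<d. (w $ a)\<^sup>2)" by (rule sum_squares_vec_pos[OF w(1,2)])
  have "bform d (\<lambda>a b. ?G $$ (a, b)) (\<lambda>a. w $ a) (\<lambda>a. w $ a) = \<mu> * (\<Sum>a<d. (w $ a)\<^sup>2)"
    using bform_eigenvector[OF \<Gamma> w(1,3)] unfolding shift by (simp add: \<mu>_def distrib_right)
  moreover have "0 \<le> bform d (\<lambda>a b. ?G $$ (a, b)) (\<lambda>a. w $ a) (\<lambda>a. w $ a)"
    unfolding d_def by (rule gram_form_nonneg[OF hyp])
  moreover have "bform d (\<lambda>a b. ?G $$ (a, b)) (\<lambda>a. w $ a) (\<lambda>a. w $ a) \<noteq> 0"
  proof
    assume "bform d (\<lambda>a b. ?G $$ (a, b)) (\<lambda>a. w $ a) (\<lambda>a. w $ a) = 0"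
    from gram_form_zero[OF hyp this[unfolded d_def]] have "w $ a = 0" if "a < d" for a
      using that unfolding d_def .
    then show False using pos by simp
  qed
  ultimately have "0 < \<mu> * (\<Sum>a<d. (w $ a)\<^sup>2)" by linarith
  then have \<mu>: "\<mu> > 0" using pos by (rule zero_less_mult_pos2)

  \<comment> \<open>Trace estimates for the quotient\<close>
  have tr: "(\<Sum>a<d. ?M $$ (a, a)) = real d" by (simp add: gram_quotient_def d_def)
  \<comment> \<open>The hypothesis varies the second vector index, whereas the quotient varies the
    first, hence the passage through \<open>transition_prob_commute\<close>; \<open>r\<close> is
    taken to be the omitted index \<open>n - 1\<close>.\<close>
  have off: "\<bar>?M $$ (a, b)\<bar> \<le> \<epsilon>" if "a < d" "b < d" "a div (n - 1) \<noteq> b div (n - 1)" for a b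
  proof -
    note ia = index_bounds[OF assms(1), of a] and ib = index_bounds[OF assms(1), of b]
    show ?thesis
      using that assms(5)[of "b div (n - 1)" "a div (n - 1)" "b mod (n - 1)" "a mod (n - 1)" "n - 1"] ia ib assms(1)
        transition_prob_commute[OF assms(2,3), of "a div (n - 1)" "b div (n - 1)" _ "b mod (n - 1)"]
      by (simp add: gram_quotient_def Let_def d_def)
  qed
  have "?M $$ (a, b) * ?M $$ (b, a) \<le> (if a = b then 1 else 0) + \<epsilon>\<^sup>2" if "a < d" "b < d" for a b
  proof (cases "a div (n - 1) = b div (n - 1)")
    case True
    then show ?thesis using that by (auto simp: gram_quotient_def d_def)
  next
    case False
    have "\<bar>?M $$ (a, b)\<bar> * \<bar>?M $$ (b, a)\<bar> \<le> \<epsilon> * \<epsilon>"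
      using off[OF that False] off[OF that(2,1)] False assms(4) by (intro mult_mono) auto
    then show ?thesis using False by (auto simp: power2_eq_square abs_mult[symmetric])
  qed
  then have "(\<Sum>a<d. \<Sum>b<d. ?M $$ (a, b) * ?M $$ (b, a)) \<le> (\<Sum>a<d. \<Sum>b<d. (if a = b then 1 else 0) + \<epsilon>\<^sup>2)"
    by (intro sum_mono) auto
  also have "\<dots> = real d + (real d)\<^sup>2 * \<epsilon>\<^sup>2"
    by (simp add: sum.distrib power2_eq_square algebra_simps)
  finally have tr2: "(\<Sum>a<d. \<Sum>b<d. ?M $$ (a, b) * ?M $$ (b, a)) - real d \<le> (real d)\<^sup>2 * \<epsilon>\<^sup>2" by simp
  have "(real d)\<^sup>2 \<le> ((real n)\<^sup>2 - real n)\<^sup>2 * real d"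
  proof -
    \<comment> \<open>After this substitution the difference of the two sides is a polynomial in
      \<open>p\<close> with nonnegative coefficients.\<close>
    obtain p where "n = p + 2" using assms(1) by (metis add.commute le_Suc_ex)
    then have "(real n)\<^sup>2 - 1 \<le> ((real n)\<^sup>2 - real n)\<^sup>2"
      by (simp add: power2_eq_square algebra_simps)
    then have "real d \<le> ((real n)\<^sup>2 - real n)\<^sup>2" using dreal by simp
    from mult_right_mono[OF this, of "real d"] show ?thesis by (simp add: power2_eq_square)
  qed
  then have "(real d)\<^sup>2 * \<epsilon>\<^sup>2 \<le> ((real n)\<^sup>2 - real n)\<^sup>2 * ((real n)\<^sup>2 - 1) * \<epsilon>\<^sup>2"
    unfolding dreal by (rule mult_right_mono) simp
  with tr2 have "((\<Sum>a<d. \<Sum>b<d. ?M $$ (a, b) * ?M $$ (b, a)) - real d) / \<mu>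
      \<le> ((real n)\<^sup>2 - real n)\<^sup>2 * ((real n)\<^sup>2 - 1) * \<epsilon>\<^sup>2 / \<mu>"
    using \<mu> by (intro divide_right_mono) auto
  then have e: "exp (((\<Sum>a<d. \<Sum>b<d. ?M $$ (a, b) * ?M $$ (b, a)) - real d) / \<mu>)
      \<le> exp (((real n)\<^sup>2 - real n)\<^sup>2 * ((real n)\<^sup>2 - 1) * \<epsilon>\<^sup>2 / \<mu>)" by simp

  \<comment> \<open>Comparison of determinants\<close>
  have ge1: "1 \<le> exp (((\<Sum>a<d. \<Sum>b<d. ?M $$ (a, b) * ?M $$ (b, a)) - real d) / \<mu>) * Determinant.det ?M"
  proof (rule det_lower_bound_trace[OF M \<mu> _ tr])
    fix z assume "eigenvalue (map_mat complex_of_real ?M) z"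
    then show "\<exists>x\<ge>\<mu>. z = of_real x"
      using relative_eigenvalue_real[OF M D GM symG symD \<mu> low]
        gram_diag_form_nonneg[OF hyp] gram_diag_form_le[OF hyp] unfolding d_def by blast
  qed
  \<comment> \<open>Positivity of the determinant is what permits enlarging the exponential
    factor.\<close>
  then have "0 < Determinant.det ?M" by (smt (verit) exp_gt_zero mult_nonneg_nonpos)
  then have "1 \<le> exp (((real n)\<^sup>2 - real n)\<^sup>2 * ((real n)\<^sup>2 - 1) * \<epsilon>\<^sup>2 / \<mu>) * Determinant.det ?M"
    using ge1 mult_right_mono[OF e, of "Determinant.det ?M"] by linarith
  moreover have "Determinant.det ?G = Determinant.det ?D * Determinant.det ?M"
    unfolding GM by (rule det_mult[OF D M])
  \<comment> \<open>By multiplicativity the block-diagonal part is nonsingular as well, so the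
    quotient of the determinants is that of \<open>?M\<close>.\<close>
  moreover have "Determinant.det ?G \<noteq> 0" by (rule det_gram_nonzero[OF hyp])
  ultimately show ?thesis by (simp add: \<mu>_def)
qed

end
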